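(* Let $(A,\to,\rightsquigarrow,0,1)$ be a bounded commutative pseudo BE-algebra and let $\tau:A\to A$ be a map satisfying, for all $x,y\in A$: (U1) $\tau x\le x$; (U2) $(\tau (x^{-}))^{\sim}=(\tau (x^{\sim}))^{-}$; (U3) $\tau(x\oplus(\tau y)^{-})=\tau x\oplus(\tau y)^{-}$ and $\tau((\tau x)^{\sim}\oplus y)=(\tau x)^{\sim}\oplus\tau y$; (U4) $\tau(x\oplus\tau y)=\tau(\tau x\oplus y)=\tau x\oplus\tau y$; (U5) $\tau((x^{-}\oplus x^{-})^{\sim})=((\tau x)^{-}\oplus(\tau x)^{-})^{\sim}$ and $\tau((x^{\sim}\oplus x^{\sim})^{-})=((\tau x)^{\sim}\oplus(\tau x)^{\sim})^{-}$; (U6) $\tau(x\oplus x)=\tau x\oplus\tau x$. Define $\forall,\exists:A\to A$ by $\forall x=\tau x$ and $\exists x=(\tau(x^{-}))^{\sim}=(\tau(x^{\sim}))^{-}$ for all $x\in A$. Then $(A,\exists,\forall)$ is a monadic bounded commutative pseudo BE-algebra.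
   Context: A pseudo BE-algebra is an algebra $(A,\to,\rightsquigarrow,1)$ of type $(2,2,0)$ such that for all $x,y,z\in A$: $x\to x=x\rightsquigarrow x=1$; $x\to 1=x\rightsquigarrow 1=1$; $1\to x=1\rightsquigarrow x=x$; $x\to(y\rightsquigarrow z)=y\rightsquigarrow(x\to z)$; and $x\to y=1$ iff $x\rightsquigarrow y=1$. One writes $x\le y$ iff $x\to y=1$ (equivalently $x\rightsquigarrow y=1$). It is commutative if $(x\to y)\rightsquigarrow y=(y\to x)\rightsquigarrow x$ and $(x\rightsquigarrow y)\to y=(y\rightsquigarrow x)\to x$ for all $x,y$. It is bounded if it has an element $0$ with $0\le x$ for all $x$; then $x^{-}=x\to 0$ and $x^{\sim}=x\rightsquigarrow 0$. In a bounded commutative pseudo BE-algebra, $\le$ is a partial order, $x^{-\sim}=x^{\sim-}=x$, and one sets $x\oplus y=y^{\sim}\to x=x^{-}\rightsquigarrow y$ and $x\odot y=(x\to y^{-})^{\sim}=(y\rightsquigarrow x^{\sim})^{-}$ (which equals $\min\{z: x\le y\to z\}$ and $(y^{-}\oplus x^{-})^{\sim}=(y^{\sim}\oplus x^{\sim})^{-}$). A monadic bounded commutative pseudo BE-algebra is a bounded commutative pseudo BE-algebra with maps $\exists,\forall:A\to A$ such that for all $x,y\in A$: (M1) $x\to\exists x=x\rightsquigarrow\exists x=1$; (M2) $\forall x\to x=\forall x\rightsquigarrow x=1$; (M3) $\forall(x\to\exists y)=\exists x\to\exists y$ and $\forall(x\rightsquigarrow\exists y)=\exists x\rightsquigarrow\exists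 y$; (M4) $\forall(\exists x\to y)=\exists x\to\forall y$ and $\forall(\exists x\rightsquigarrow y)=\exists x\rightsquigarrow\forall y$; (M5) $\exists\forall x=\forall x$; (M6) $\forall(x\odot x)=\forall x\odot\forall x$; (M7) $\forall(x\oplus x)=\forall x\oplus\forall x$. *)

theory Defs
  imports Main
begin

class pseudo_be = one +
  fixes imp :: "'a \<Rightarrow> 'a \<Rightarrow> 'a"  (infixr "\<rightarrow>" 60)
    and wimp :: "'a \<Rightarrow> 'a \<Rightarrow> 'a"  (infixr "\<leadsto>" 60)
  assumes imp_self: "x \<rightarrow> x = 1"
    and wimp_self: "x \<leadsto> x = 1"
    and imp_one: "x \<rightarrow> 1 = 1"
    and wimp_one: "x \<leadsto> 1 = 1"
    and one_imp: "1 \<rightarrow> x = x"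
    and one_wimp: "1 \<leadsto> x = x"
    and exchange: "x \<rightarrow> (y \<leadsto> z) = y \<leadsto> (x \<rightarrow> z)"
    and imp_eq_one_iff: "x \<rightarrow> y = 1 \<longleftrightarrow> x \<leadsto> y = 1"
begin

definition be_le :: "'a \<Rightarrow> 'a \<Rightarrow> bool"  (infix "\<sqsubseteq>" 50)
  where "x \<sqsubseteq> y \<longleftrightarrow> x \<rightarrow> y = 1"

end

class commutative_pseudo_be = pseudo_be +
  assumes imp_wimp_commute: "(x \<rightarrow> y) \<leadsto> y = (y \<rightarrow> x) \<leadsto> x"
    and wimp_imp_commute: "(x \<leadsto> y) \<rightarrow> y = (y \<leadsto> x) \<rightarrow> x"

class bounded_pseudo_be = pseudo_be + zero +
  assumes zero_le: "0 \<sqsubseteq> x"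
begin

definition neg :: "'a \<Rightarrow> 'a"  ("_\<^sup>-" [1000] 1000)
  where "x\<^sup>- = x \<rightarrow> 0"

definition wneg :: "'a \<Rightarrow> 'a"  ("_\<^sup>\<sim>" [1000] 1000)
  where "x\<^sup>\<sim> = x \<leadsto> 0"

end

class bounded_commutative_pseudo_be = bounded_pseudo_be + commutative_pseudo_be
begin

definition oplus :: "'a \<Rightarrow> 'a \<Rightarrow> 'a"  (infixl "\<oplus>" 65)
  where "x \<oplus> y = y\<^sup>\<sim> \<rightarrow> x"

definition odot :: "'a \<Rightarrow> 'a \<Rightarrow> 'a"  (infixl "\<odot>" 70)
  where "x \<odot> y = (x \<rightarrow> y\<^sup>-)\<^sup>\<sim>"

lemma wneg_neg: "x\<^sup>-\<^sup>\<sim> = x"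
  using imp_wimp_commute[of x 0] zero_le[of x] by (simp add: neg_def wneg_def be_le_def one_wimp)

lemma neg_wneg: "x\<^sup>\<sim>\<^sup>- = x"
  using wimp_imp_commute[of x 0] zero_le[of x]
  by (simp add: neg_def wneg_def be_le_def one_imp imp_eq_one_iff)

lemma oplus_alt: "x \<oplus> y = x\<^sup>- \<leadsto> y"
proof -
  have "y\<^sup>\<sim> \<rightarrow> (x\<^sup>- \<leadsto> 0) = x\<^sup>- \<leadsto> (y\<^sup>\<sim> \<rightarrow> 0)" by (rule exchange)
  then show ?thesis using wneg_neg[of x] neg_wneg[of y] by (simp add: oplus_def neg_def wneg_def)
qed

lemma be_le_antisym:
  assumes "x \<sqsubseteq> y" "y \<sqsubseteq> x" shows "x = y"
  using imp_wimp_commute[of x y] assms by (simp add: be_le_def one_wimp)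

lemma odot_le_iff: "x \<odot> y \<sqsubseteq> z \<longleftrightarrow> x \<sqsubseteq> y \<rightarrow> z"
proof -
  have contra: "z\<^sup>- \<leadsto> u\<^sup>- = u \<rightarrow> z" for u
    using exchange[of u "z\<^sup>-" 0] wneg_neg[of z] by (simp add: neg_def wneg_def)
  have "x \<odot> y \<rightarrow> z = z\<^sup>- \<leadsto> (x \<rightarrow> y\<^sup>-)"
    by (simp add: contra[symmetric] odot_def neg_wneg)
  also have "\<dots> = x \<rightarrow> (y \<rightarrow> z)" by (simp add: exchange[symmetric] contra)
  finally show ?thesis by (simp add: be_le_def)
qed

lemma odot_alt: "x \<odot> y = (y \<leadsto> x\<^sup>\<sim>)\<^sup>-"
proof -
  let ?q = "(y \<leadsto> x\<^sup>\<sim>)\<^sup>-"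
  have contra: "z\<^sup>\<sim> \<rightarrow> u\<^sup>\<sim> = u \<leadsto> z" for u z
    using exchange[of "z\<^sup>\<sim>" u 0] neg_wneg[of z] by (simp add: neg_def wneg_def)
  have q: "?q \<sqsubseteq> z \<longleftrightarrow> x \<sqsubseteq> y \<rightarrow> z" for z
  proof -
    have "?q \<leadsto> z = z\<^sup>\<sim> \<rightarrow> (y \<leadsto> x\<^sup>\<sim>)"
      by (simp add: contra[symmetric] wneg_neg)
    also have "\<dots> = y \<leadsto> (x \<leadsto> z)" by (simp add: exchange contra)
    finally show ?thesis
      by (simp add: be_le_def imp_eq_one_iff[of ?q] imp_eq_one_iff[of x]
          exchange[symmetric] imp_eq_one_iff[of y "x \<leadsto> z", symmetric])
  qed
  show ?thesis
    using q odot_le_iff imp_self by (metis be_le_antisym be_le_def)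
qed

end

locale monadic_bounded_commutative_pseudo_be =
  fixes exq allq :: "'a::bounded_commutative_pseudo_be \<Rightarrow> 'a"
  assumes M1: "x \<rightarrow> exq x = 1" "x \<leadsto> exq x = 1"
    and M2: "allq x \<rightarrow> x = 1" "allq x \<leadsto> x = 1"
    and M3: "allq (x \<rightarrow> exq y) = exq x \<rightarrow> exq y" "allq (x \<leadsto> exq y) = exq x \<leadsto> exq y"
    and M4: "allq (exq x \<rightarrow> y) = exq x \<rightarrow> allq y" "allq (exq x \<leadsto> y) = exq x \<leadsto> allq y"
    and M5: "exq (allq x) = allq x"
    and M6: "allq (x \<odot> x) = allq x \<odot> allq x"
    and M7: "allq (x \<oplus> x) = allq x \<oplus> allq x"

end

theory Submission
  imports Defs
begin

text \<open>
  The two arrows are sums in disguise: \<open>y \<rightarrow> x = x \<oplus> y\<^sup>-\<close> and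
  \<open>x \<leadsto> y = x\<^sup>\<sim> \<oplus> y\<close>.  The proof reads the arrows of (M3), (M4) and (M6) as such
  a sum.  Write \<open>\<exists>x\<close> for \<open>(\<tau> (x\<^sup>-))\<^sup>\<sim>\<close>, which (U2) equates with \<open>(\<tau> (x\<^sup>\<sim>))\<^sup>-\<close>.
  Whichever form is used, one of the two negations strips the outer one:
  \<open>(\<exists>x)\<^sup>- = \<tau> (x\<^sup>-)\<close> and \<open>(\<exists>x)\<^sup>\<sim> = \<tau> (x\<^sup>\<sim>)\<close>.

  An \<open>\<exists>\<close> in the conclusion of an arrow is a summand that is a negation of a value of
  \<open>\<tau>\<close>, and (U3) lets \<open>\<tau>\<close> pass over it: this is (M3).  An \<open>\<exists>\<close> in the premise
  becomes, once negated, a summand that is itself a value of \<open>\<tau>\<close>, and (U4) does the same: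
  this is (M4).  (M5) amounts to \<open>(\<tau> x)\<^sup>-\<close> being a fixed point of \<open>\<tau>\<close>; it is the case
  of (U3) in which the other summand is \<open>0\<close>, as (U1) forces \<open>\<tau> 0 = 0\<close>.  (M6) is (U5),
  because \<open>x \<odot> x\<close> is a negated sum, and (M1) is (U1) under order-reversing negation.
\<close>

context bounded_commutative_pseudo_be
begin

lemma imp_eq_oplus: "y \<rightarrow> x = x \<oplus> y\<^sup>-"
  by (simp add: oplus_def wneg_neg)

lemma wimp_eq_oplus: "x \<leadsto> y = x\<^sup>\<sim> \<oplus> y"
  by (simp add: oplus_alt neg_wneg)

lemma zero_oplus: "0 \<oplus> x = x"
  by (simp add: oplus_def neg_def[symmetric] neg_wneg)

lemma le_zero_imp_eq: "x \<sqsubseteq> 0 \<Longrightarrow> x = 0"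
  by (rule be_le_antisym[OF _ zero_le])

text \<open>
  The exchange law turns \<open>x \<rightarrow> (y \<leadsto> 0)\<close> into \<open>y \<leadsto> (x \<rightarrow> 0)\<close>, so the two negations
  form a Galois connection.
\<close>

lemma le_wneg_iff_le_neg: "x \<sqsubseteq> y\<^sup>\<sim> \<longleftrightarrow> y \<sqsubseteq> x\<^sup>-"
  by (simp add: be_le_def neg_def wneg_def exchange imp_eq_one_iff[of y])

end

theorem theorem4p12:
  fixes \<tau> :: "'a::bounded_commutative_pseudo_be \<Rightarrow> 'a"
  assumes U1: "\<And>x. \<tau> x \<sqsubseteq> x"
    and U2: "\<And>x. (\<tau> (x\<^sup>-))\<^sup>\<sim> = (\<tau> (x\<^sup>\<sim>))\<^sup>-"
    and U3: "\<And>x y. \<tau> (x \<oplus> (\<tau> y)\<^sup>-) = \<tau> x \<oplus> (\<tau> y)\<^sup>-"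
            "\<And>x y. \<tau> ((\<tau> x)\<^sup>\<sim> \<oplus> y) = (\<tau> x)\<^sup>\<sim> \<oplus> \<tau> y"
    and U4: "\<And>x y. \<tau> (x \<oplus> \<tau> y) = \<tau> x \<oplus> \<tau> y"
            "\<And>x y. \<tau> (\<tau> x \<oplus> y) = \<tau> x \<oplus> \<tau> y"
    and U5: "\<And>x. \<tau> ((x\<^sup>- \<oplus> x\<^sup>-)\<^sup>\<sim>) = ((\<tau> x)\<^sup>- \<oplus> (\<tau> x)\<^sup>-)\<^sup>\<sim>"
            "\<And>x. \<tau> ((x\<^sup>\<sim> \<oplus> x\<^sup>\<sim>)\<^sup>-) = ((\<tau> x)\<^sup>\<sim> \<oplus> (\<tau> x)\<^sup>\<sim>)\<^sup>-"
    and U6: "\<And>x. \<tau> (x \<oplus> x) = \<tau> x \<oplus> \<tau> x"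
  shows "monadic_bounded_commutative_pseudo_be (\<lambda>x. (\<tau> (x\<^sup>-))\<^sup>\<sim>) (\<lambda>x. \<tau> x)"
proof -
  let ?ex = "\<lambda>x. (\<tau> (x\<^sup>-))\<^sup>\<sim>"
  have ex_neg: "(?ex x)\<^sup>- = \<tau> (x\<^sup>-)" for x
    by (rule neg_wneg)
  have ex_wneg: "(?ex x)\<^sup>\<sim> = \<tau> (x\<^sup>\<sim>)" for x
    by (simp only: U2 wneg_neg)
  have imp_ex: "x \<rightarrow> ?ex x = 1" for x
    using U1[of "x\<^sup>-"] le_wneg_iff_le_neg[of x "\<tau> (x\<^sup>-)"] by (simp add: be_le_def)
  have \<tau>_imp: "\<tau> x \<rightarrow> x = 1" for x
    using U1[of x] by (simp add: be_le_def)
  have "\<tau> 0 = 0"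
    using U1[of 0] by (rule le_zero_imp_eq)
  then have \<tau>_neg: "\<tau> ((\<tau> x)\<^sup>-) = (\<tau> x)\<^sup>-" for x
    using U3(1)[of 0 x] by (simp add: zero_oplus)
  show ?thesis
  proof
    fix x y
    show "x \<rightarrow> ?ex x = 1" by (rule imp_ex)
    then show "x \<leadsto> ?ex x = 1" by (simp only: imp_eq_one_iff)
    show "\<tau> x \<rightarrow> x = 1" by (rule \<tau>_imp)
    then show "\<tau> x \<leadsto> x = 1" by (simp only: imp_eq_one_iff)
    show "\<tau> (x \<rightarrow> ?ex y) = ?ex x \<rightarrow> ?ex y"
      by (simp only: imp_eq_oplus[of x] imp_eq_oplus[of "?ex x"] ex_neg U3(2))
    \<comment> \<open>Here the \<open>\<exists>\<close> must be a right summand of the shape \<open>(\<tau> z)\<^sup>-\<close>, hence the other form.\<close>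
    show "\<tau> (x \<leadsto> ?ex y) = ?ex x \<leadsto> ?ex y"
      by (simp only: wimp_eq_oplus[of x] wimp_eq_oplus[of "?ex x"] ex_wneg U2[of y] U3(1))
    show "\<tau> (?ex x \<rightarrow> y) = ?ex x \<rightarrow> \<tau> y"
      by (simp only: imp_eq_oplus[of "?ex x"] ex_neg U4(1))
    show "\<tau> (?ex x \<leadsto> y) = ?ex x \<leadsto> \<tau> y"
      by (simp only: wimp_eq_oplus[of "?ex x"] ex_wneg U4(2))
    show "?ex (\<tau> x) = \<tau> x"
      by (simp only: \<tau>_neg wneg_neg)
    show "\<tau> (x \<odot> x) = \<tau> x \<odot> \<tau> x"
      by (simp only: odot_def imp_eq_oplus U5(1))
    show "\<tau> (x \<oplus> x) = \<tau> x \<oplus> \<tau> x"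
      by (rule U6)
  qed
qed

end
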